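(* There is an absolute integer $d_0$ such that, for every integer $d\ge d_0$ divisible by $4$ and every integer $r\ge 1$, there is a simple nonhamiltonian $d$-regular graph $G=G(d,r)$ of order $2^{r+1}d+2d+1$ such that every nonempty set $X\subseteq V(G)$ with $|X|\le |V(G)|/2$ satisfies $|N_G(X)|\ge |X|/72$.
   Context: All graphs are finite, simple and undirected. For a graph $G$ and $X\subseteq V(G)$, the external neighborhood of $X$ is $N_G(X)=\{v\in V(G)\setminus X : v \text{ has a neighbor in } X\}$. A graph is hamiltonian if it has a cycle containing every vertex, and nonhamiltonian otherwise. *)

theory Defs
  imports Complex_Main "Graph_Theory.Pair_Digraph"
begin

text \<open>
  Finite simple undirected graphs are the \<^locale>\<open>pair_graph\<close>s of the library: an undirected edge
  $\{u,v\}$ is represented by the two arcs $(u,v)$ and $(v,u)$.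
\<close>

definition external_neighborhood :: "'a pair_pre_digraph \<Rightarrow> 'a set \<Rightarrow> 'a set" where
  "external_neighborhood G X = {v \<in> pverts G - X. \<exists>x\<in>X. (v, x) \<in> parcs G}"

text \<open>The arcs are symmetric, so the out-degree is the usual degree.\<close>

definition regular_graph :: "'a pair_pre_digraph \<Rightarrow> nat \<Rightarrow> bool" where
  "regular_graph G d \<longleftrightarrow> (\<forall>v\<in>pverts G. out_degree (with_proj G) v = d)"

text \<open>
  The library's cycles are directed and so include the walk $u,v,u$ along a single edge.  The bound
  on the length excludes it, leaving exactly the cycles of the undirected graph.  The vertices of a
  cycle are the tails of its arcs.
\<close>

definition hamiltonian :: "'a pair_pre_digraph \<Rightarrow> bool" where
  "hamiltonian G \<longleftrightarrow>
     (\<exists>p. pre_digraph.cycle (with_proj G) p \<and> 3 \<le> length p \<and> pverts G \<subseteq> fst ` set p)"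

end

theory Submission
  imports Defs "HOL-Combinatorics.Permutations" "HOL-Library.FuncSet" "HOL-Library.Countable"
begin

text \<open>
  Let \<open>N = 2^r d\<close> and let \<open>F\<close> be a \<open>d\<close>-regular bipartite graph with sides \<open>L\<close>, \<open>R\<close> of size \<open>N\<close>.  Delete a
  vertex \<open>v0\<close> of \<open>R\<close>, and repair the degrees of its \<open>d\<close> neighbours with two copies of \<open>K_{d+1}\<close>, each
  minus a matching of \<open>d/4\<close> edges: the \<open>d/2\<close> ends of each matching are joined to half of these
  neighbours.  Removing the \<open>N\<close> vertices of \<open>L\<close> leaves \<open>N + 1\<close> components, namely \<open>N - 1\<close> single
  vertices and two cliques, so the graph is not Hamiltonian.

  For the expansion, \<open>F\<close> is a random \<open>2^r\<close>-fold lift of \<open>K_{d,d}\<close>.  The neighbourhood of a set \<open>Y\<close> lies in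
  a set \<open>W\<close> of the other side with probability at most \<open>(|W| / N)^(d |Y|)\<close>.  A union bound therefore yields,
  for large \<open>d\<close>, a lift in which sets of size at most \<open>N/6\<close> expand threefold and any two sets of size
  at least \<open>N/6\<close> on opposite sides are joined by an edge.
\<close>

section \<open>Counting permutations\<close>

text \<open>Composition with the transposition of \<open>x\<close> and \<open>z\<close> shows that the number of \<open>p\<close> with \<open>p z \<in> B\<close> is the
  same for all \<open>z\<close> outside \<open>A\<close>; both sides count the pairs \<open>(p, z)\<close> with \<open>z \<in> S - A\<close> and \<open>p z \<in> B\<close>.\<close>

lemma card_permutes_image_subset_step:
  assumes "finite S" "A \<subseteq> S" "B \<subseteq> S" "x \<in> S - A"
  shows "(card S - card A) * card {p. p permutes S \<and> p ` insert x A \<subseteq> B}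
       = (card B - card A) * card {p. p permutes S \<and> p ` A \<subseteq> B}"
proof -
  define T where "T = {p. p permutes S \<and> p ` A \<subseteq> B}"
  define h where "h z = {p \<in> T. p z \<in> B}" for z
  have finT: "finite T"
    unfolding T_def by (rule finite_subset[OF _ finite_permutations[OF assms(1)]]) auto
  have finA: "finite A" using assms finite_subset by blast
  have swap: "p \<circ> transpose x z \<in> h z'" if "p \<in> h z''" "z \<in> S - A" "{z', z''} = {x, z}" for p z z' z''
  proof -
    have "p permutes S" "p ` A \<subseteq> B" "p z'' \<in> B" using that by (auto simp: h_def T_def)
    moreover have "transpose x z permutes S" using assms that by (intro permutes_swap_id) auto
    moreover have "(p \<circ> transpose x z) ` A = p ` A"
      using assms that by (auto simp: transpose_def image_iff)
    moreover have "(p \<circ> transpose x z) z' = p z''"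
      using that(3) by (auto simp: transpose_def doubleton_eq_iff)
    ultimately show ?thesis by (auto simp: h_def T_def intro: permutes_compose)
  qed
  have "card (h z) = card (h x)" if "z \<in> S - A" for z
  proof -
    have "bij_betw (\<lambda>p. p \<circ> transpose x z) (h z) (h x)"
      by (rule bij_betw_byWitness[where f' = "\<lambda>p. p \<circ> transpose x z"])
        (use swap[OF _ that, of _ z x] swap[OF _ that, of _ x z] in
          \<open>auto simp: comp_assoc insert_commute\<close>)
    then show ?thesis by (rule bij_betw_same_card)
  qed
  then have "(\<Sum>z\<in>S - A. card (h z)) = (\<Sum>z\<in>S - A. card (h x))"
    by (intro sum.cong refl)
  also have "\<dots> = (card S - card A) * card (h x)"
    using assms finA by (simp add: card_Diff_subset)
  finally have "(\<Sum>z\<in>S - A. card (h z)) = (card S - card A) * card (h x)" .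
  moreover have "(\<Sum>z\<in>S - A. card (h z)) = (\<Sum>p\<in>T. card {z \<in> S - A. p z \<in> B})"
    unfolding h_def using assms finT
    by (intro sum_multicount_gen[where R = "\<lambda>z p. p z \<in> B"]) auto
  \<comment> \<open>Being injective, \<open>p\<close> uses up \<open>card A\<close> elements of
    \<open>B\<close> on \<open>A\<close>; being onto \<open>S\<close>, it takes each other element
    of \<open>B\<close> exactly once, at a point outside \<open>A\<close>.\<close>
  moreover have "card {z \<in> S - A. p z \<in> B} = card B - card A" if "p \<in> T" for p
  proof -
    have p: "p permutes S" "p ` A \<subseteq> B" using that by (auto simp: T_def)
    have "p ` {z \<in> S - A. p z \<in> B} = B - p ` A"
    proof (intro equalityI subsetI)
      fix y assume y: "y \<in> B - p ` A"
      then have "y \<in> p ` S" using assms permutes_image[OF p(1)] by auto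
      with y show "y \<in> p ` {z \<in> S - A. p z \<in> B}" by auto
    qed (use permutes_inj[OF p(1)] in \<open>auto dest: injD\<close>)
    moreover have "inj_on p X" for X using p permutes_inj_on by blast
    ultimately have "card {z \<in> S - A. p z \<in> B} = card (B - p ` A)"
      by (metis (no_types) card_image)
    also have "\<dots> = card B - card A"
      using p finA \<open>\<And>X. inj_on p X\<close> by (simp add: card_Diff_subset card_image)
    finally show ?thesis .
  qed
  ultimately have "(card S - card A) * card (h x) = (card B - card A) * card T"
    by (simp add: mult.commute)
  moreover have "h x = {p. p permutes S \<and> p ` insert x A \<subseteq> B}"
    by (auto simp: h_def T_def)
  ultimately show ?thesis by (simp add: T_def)
qed

text \<open>Adding the points of \<open>A\<close> one at a time gives the probability as a product
  of factors \<open>(b - i) / (s - i)\<close>, each at most \<open>b / s\<close> because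
  \<open>b \<le> s\<close>.\<close>

lemma card_permutes_image_subset_le:
  assumes "finite S" "A \<subseteq> S" "B \<subseteq> S"
  shows "real (card {p. p permutes S \<and> p ` A \<subseteq> B})
       \<le> fact (card S) * (card B / card S) ^ card A"
proof -
  have "finite A" using assms finite_subset by blast
  then show ?thesis using assms(2)
  proof (induction A)
    case empty
    then show ?case using assms by (simp add: card_permutations)
  next
    case (insert x A)
    define s b a where "s = card S" "b = card B" "a = card A"
    have "card (insert x A) \<le> s" unfolding s_b_a_def using insert assms by (intro card_mono) auto
    then have a: "a < s" using insert by (simp add: s_b_a_def)
    have b: "b \<le> s" unfolding s_b_a_def using assms by (intro card_mono) auto
    let ?T = "\<lambda>A. real (card {p. p permutes S \<and> p ` A \<subseteq> B})"
    have "real (s - a) * ?T (insert x A) = real (b - a) * ?T A"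
      unfolding s_b_a_def of_nat_mult[symmetric]
      by (subst card_permutes_image_subset_step) (use insert assms in auto)
    \<comment> \<open>For \<open>a > b\<close> the truncated difference \<open>b - a\<close> is 0,
      matching the fact that no injection exists.\<close>
    moreover have "real (b - a) * s \<le> real b * (s - a)"
    proof (cases "a \<le> b")
      case True
      then show ?thesis using a b mult_left_mono[of b s "real a"] by (simp add: of_nat_diff algebra_simps)
    qed (use a in simp)
    then have "real (b - a) \<le> real (s - a) * (b / s)"
      using a by (auto simp: field_simps of_nat_diff)
    then have "real (b - a) * ?T A \<le> real (s - a) * (b / s) * ?T A"
      by (rule mult_right_mono) auto
    ultimately have "real (s - a) * ?T (insert x A) \<le> real (s - a) * ((b / s) * ?T A)"
      by (simp add: mult.assoc)
    then have "?T (insert x A) \<le> (b / s) * ?T A" using a by (subst (asm) mult_le_cancel_left_pos) auto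
    also have "\<dots> \<le> (b / s) * (fact s * (b / s) ^ a)"
      using insert unfolding s_b_a_def by (intro mult_left_mono) auto
    finally show ?case using insert by (simp add: s_b_a_def ac_simps)
  qed
qed

text \<open>Inversion is a bijection of the permutations of \<open>S\<close> that exchanges images
  and preimages.\<close>

lemma card_permutes_vimage_subset_le:
  assumes "finite S" "A \<subseteq> S" "B \<subseteq> S"
  shows "real (card {p. p permutes S \<and> p -` A \<subseteq> B})
       \<le> fact (card S) * (card B / card S) ^ card A"
proof -
  have inv: "inv p ` A = p -` A \<and> inv p -` A = p ` A" if "p permutes S" for p
    using bij_vimage_eq_inv_image[OF permutes_bij[OF that], of A]
      bij_vimage_eq_inv_image[OF permutes_bij[OF permutes_inv[OF that]], of A]
    by (simp add: permutes_inv_inv[OF that])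
  have "bij_betw inv {p. p permutes S \<and> p -` A \<subseteq> B} {p. p permutes S \<and> p ` A \<subseteq> B}"
    by (rule bij_betw_byWitness[where f' = inv])
      (use inv in \<open>force simp: permutes_inv permutes_inv_inv simp del: image_subset_iff\<close>)+
  then show ?thesis
    using card_permutes_image_subset_le[OF assms] by (simp add: bij_betw_same_card)
qed

text \<open>AM-GM. With mean \<open>s > 0\<close>, the inequality \<open>1 + t \<le> exp t\<close>
  at \<open>t = w i / s - 1\<close> bounds each factor, and these exponents sum to 0.\<close>

lemma prod_le_mean_power:
  fixes w :: "'a \<Rightarrow> real"
  assumes "finite I" "\<And>i. i \<in> I \<Longrightarrow> 0 \<le> w i"
  shows "(\<Prod>i\<in>I. w i) \<le> (sum w I / card I) ^ card I"
proof (cases "I = {}")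
  case False
  define s where "s = sum w I / card I"
  have s0: "s \<ge> 0" unfolding s_def by (simp add: assms sum_nonneg)
  show ?thesis
  proof (cases "s = 0")
    case True
    then have "sum w I = 0" using False assms by (auto simp: s_def)
    then have "\<forall>i\<in>I. w i = 0" using assms by (simp add: sum_nonneg_eq_0_iff)
    then show ?thesis using False assms by (auto simp: s_def[symmetric] True)
  next
    case s: False
    have "w i \<le> s * exp (w i / s - 1)" for i
      using exp_ge_add_one_self[of "w i / s - 1"] s s0 by (simp add: field_simps)
    then have "(\<Prod>i\<in>I. w i) \<le> (\<Prod>i\<in>I. s * exp (w i / s - 1))"
      using assms by (intro prod_mono) auto
    also have "\<dots> = s ^ card I * exp (\<Sum>i\<in>I. w i / s - 1)"
      using assms by (simp add: prod.distrib exp_sum)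
    also have "(\<Sum>i\<in>I. w i / s - 1) = sum w I / s - card I"
      by (simp add: sum_subtractf sum_divide_distrib)
    also have "\<dots> = 0"
      using s False assms by (auto simp: s_def)
    finally show ?thesis by (simp add: s_def)
  qed
qed simp

section \<open>Random lifts of complete bipartite graphs\<close>

text \<open>The vertex \<open>(u, x)\<close> is the point \<open>u\<close> of the fibre over the vertex \<open>x\<close> of \<open>K_{d,d}\<close>.\<close>

definition lift_edges :: "nat \<Rightarrow> nat \<Rightarrow> (nat \<times> nat \<Rightarrow> nat \<Rightarrow> nat) \<Rightarrow> ((nat \<times> nat) \<times> (nat \<times> nat)) set"
  where "lift_edges m d P = {((u, x), (P (x, y) u, y)) | u x y. u < m \<and> x < d \<and> y < d}"

text \<open>The sample space: one permutation for each edge of \<open>K_{d,d}\<close>, chosen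
  independently. Extensionality makes it finite.\<close>

definition voltages :: "nat \<Rightarrow> nat \<Rightarrow> (nat \<times> nat \<Rightarrow> nat \<Rightarrow> nat) set"
  where "voltages m d = (\<Pi>\<^sub>E i\<in>{..<d} \<times> {..<d}. {p. p permutes {..<m}})"

lemma lift_edges_iff:
  "((u, x), (w, y)) \<in> lift_edges m d P \<longleftrightarrow> u < m \<and> x < d \<and> y < d \<and> w = P (x, y) u"
  by (auto simp: lift_edges_def)

lemma voltages_permutes:
  "P \<in> voltages m d \<Longrightarrow> x < d \<Longrightarrow> y < d \<Longrightarrow> P (x, y) permutes {..<m}"
  by (auto simp: voltages_def PiE_iff)

lemma lift_edges_subset:
  assumes "P \<in> voltages m d"
  shows "lift_edges m d P \<subseteq> ({..<m} \<times> {..<d}) \<times> ({..<m} \<times> {..<d})"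
  using permutes_in_image[OF voltages_permutes[OF assms]] by (fastforce simp: lift_edges_def)

lemma finite_voltages: "finite (voltages m d)"
  by (auto simp: voltages_def intro!: finite_PiE finite_permutations)

lemma card_voltages: "card (voltages m d) = fact m ^ (d * d)"
  by (simp add: voltages_def card_PiE card_permutations[of _ m])

lemma card_lift_edges_Image:
  assumes "u < m" "x < d"
  shows "card (lift_edges m d P `` {(u, x)}) = d"
proof -
  have "lift_edges m d P `` {(u, x)} = (\<lambda>y. (P (x, y) u, y)) ` {..<d}"
    using assms by (auto simp: lift_edges_def)
  also have "card \<dots> = card {..<d}" by (intro card_image inj_onI) auto
  finally show ?thesis by simp
qed

lemma card_lift_edges_converse_Image:
  assumes "P \<in> voltages m d" "w < m" "y < d"
  shows "card ((lift_edges m d P)\<inverse> `` {(w, y)}) = d"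
proof -
  have *: "P (x, y) permutes {..<m}" if "x < d" for x
    using assms that by (simp add: voltages_permutes)
  have "(lift_edges m d P)\<inverse> `` {(w, y)} = (\<lambda>x. (inv (P (x, y)) w, x)) ` {..<d}"
  proof (intro equalityI subsetI)
    fix v assume "v \<in> (\<lambda>x. (inv (P (x, y)) w, x)) ` {..<d}"
    then show "v \<in> (lift_edges m d P)\<inverse> `` {(w, y)}"
      using assms permutes_in_image[OF permutes_inv[OF *]]
      by (auto simp: lift_edges_iff permutes_inverses(1)[OF *])
  next
    fix v assume v: "v \<in> (lift_edges m d P)\<inverse> `` {(w, y)}"
    obtain u x where "v = (u, x)" by (cases v)
    with v * have "x < d" "v = (inv (P (x, y)) w, x)"
      by (auto simp: lift_edges_iff permutes_inverses(2)[OF *])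
    then show "v \<in> (\<lambda>x. (inv (P (x, y)) w, x)) ` {..<d}" by auto
  qed
  also have "card \<dots> = card {..<d}" by (intro card_image inj_onI) auto
  finally show ?thesis by simp
qed

lemma card_eq_sum_fibres:
  assumes "Y \<subseteq> {..<m::nat} \<times> {..<d::nat}"
  shows "card Y = (\<Sum>x<d. card {u. (u, x) \<in> Y})"
proof -
  have fin: "finite {u. (u, x) \<in> Y}" for x
    by (rule finite_subset[of _ "{..<m}"]) (use assms in auto)
  have "bij_betw prod.swap Y (Sigma {..<d} (\<lambda>x. {u. (u, x) \<in> Y}))"
    by (rule bij_betw_byWitness[where f' = prod.swap]) (use assms in auto)
  then show ?thesis using fin by (simp add: bij_betw_same_card)
qed

text \<open>AM-GM over the fibres removes the dependence on how the two sets are spread over them;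
  only the total sizes remain.\<close>

lemma prod_fibre_ratio_le:
  fixes w a :: "nat \<Rightarrow> nat" and m :: nat
  shows "(\<Prod>x<d. \<Prod>y<d. (real (w y) / m) ^ a x) \<le> (real (\<Sum>y<d. w y) / (m * d)) ^ (d * (\<Sum>x<d. a x))"
proof -
  have "(\<Prod>x<d. \<Prod>y<d. (real (w y) / m) ^ a x) = (\<Prod>y<d. real (w y) / m) ^ (\<Sum>x<d. a x)"
    by (simp add: prod_power_distrib power_sum)
  also have "\<dots> \<le> (((\<Sum>y<d. real (w y) / m) / card {..<d}) ^ card {..<d}) ^ (\<Sum>x<d. a x)"
    by (intro power_mono prod_le_mean_power prod_nonneg) auto
  finally show ?thesis
    by (simp add: sum_divide_distrib[symmetric] power_mult)
qed

lemma card_voltages_filter: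
  "card {P \<in> voltages m d. \<forall>x<d. \<forall>y<d. Q x y (P (x, y))}
   = (\<Prod>x<d. \<Prod>y<d. card {p. p permutes {..<m} \<and> Q x y p})"
proof -
  have "{P \<in> voltages m d. \<forall>x<d. \<forall>y<d. Q x y (P (x, y))}
      = (\<Pi>\<^sub>E i\<in>{..<d} \<times> {..<d}. {p. p permutes {..<m} \<and> Q (fst i) (snd i) p})"
    unfolding voltages_def by (intro set_eqI) (simp add: PiE_iff Ball_def, blast)
  then show ?thesis
    unfolding prod.cartesian_product by (simp add: card_PiE case_prod_unfold)
qed

text \<open>The event is a conjunction of conditions on the single permutations, each sending a
  fibre of \<open>Y\<close> into a fibre of \<open>W\<close>, so by independence the count is a
  product.\<close>

lemma card_voltages_Image_subset_le:
  assumes "Y \<subseteq> {..<m} \<times> {..<d}" "W \<subseteq> {..<m} \<times> {..<d}"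
  shows "real (card {P \<in> voltages m d. lift_edges m d P `` Y \<subseteq> W})
       \<le> card (voltages m d) * (card W / (m * d)) ^ (d * card Y)"
proof -
  define a w where "a x = {u. (u, x) \<in> Y}" and "w y = {u. (u, y) \<in> W}" for x y
  have sub: "a x \<subseteq> {..<m}" "w x \<subseteq> {..<m}" for x using assms by (auto simp: a_def w_def)
  have "(lift_edges m d P `` Y \<subseteq> W) \<longleftrightarrow> (\<forall>x<d. \<forall>y<d. P (x, y) ` a x \<subseteq> w y)" for P
  proof -
    have "(lift_edges m d P `` Y \<subseteq> W) \<longleftrightarrow> (\<forall>x<d. \<forall>y<d. \<forall>u<m. (u, x) \<in> Y \<longrightarrow> (P (x, y) u, y) \<in> W)"
      using assms(1) unfolding lift_edges_def by blast
    also have "\<dots> \<longleftrightarrow> (\<forall>x<d. \<forall>y<d. P (x, y) ` a x \<subseteq> w y)"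
      using assms(1) unfolding a_def w_def by blast
    finally show ?thesis .
  qed
  then have "real (card {P \<in> voltages m d. lift_edges m d P `` Y \<subseteq> W})
      = (\<Prod>x<d. \<Prod>y<d. real (card {p. p permutes {..<m} \<and> p ` a x \<subseteq> w y}))"
    using card_voltages_filter[of m d "\<lambda>x y p. p ` a x \<subseteq> w y"] by simp
  also have "\<dots> \<le> (\<Prod>x<d. \<Prod>y<d. fact m * (card (w y) / m) ^ card (a x))"
    using card_permutes_image_subset_le[of "{..<m}", OF _ sub] by (intro prod_mono conjI prod_nonneg) auto
  also have "\<dots> = fact m ^ (d * d) * (\<Prod>x<d. \<Prod>y<d. (card (w y) / m) ^ card (a x))"
    by (simp add: prod.distrib power_mult)
  also have "\<dots> \<le> fact m ^ (d * d) * (real (\<Sum>y<d. card (w y)) / (m * d)) ^ (d * (\<Sum>x<d. card (a x)))"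
    by (intro mult_left_mono prod_fibre_ratio_le) auto
  finally show ?thesis
    unfolding card_voltages card_eq_sum_fibres[OF assms(1)] card_eq_sum_fibres[OF assms(2)] a_def w_def
    by simp
qed

lemma card_voltages_converse_Image_subset_le:
  assumes "Y \<subseteq> {..<m} \<times> {..<d}" "W \<subseteq> {..<m} \<times> {..<d}"
  shows "real (card {P \<in> voltages m d. (lift_edges m d P)\<inverse> `` Y \<subseteq> W})
       \<le> card (voltages m d) * (card W / (m * d)) ^ (d * card Y)"
proof -
  define a w where "a x = {u. (u, x) \<in> Y}" and "w y = {u. (u, y) \<in> W}" for x y
  have sub: "a x \<subseteq> {..<m}" "w x \<subseteq> {..<m}" for x using assms by (auto simp: a_def w_def)
  have "((lift_edges m d P)\<inverse> `` Y \<subseteq> W) \<longleftrightarrow> (\<forall>x<d. \<forall>y<d. P (x, y) -` a y \<subseteq> w x)"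
    if "P \<in> voltages m d" for P
  proof -
    \<comment> \<open>Preimages are taken in all of \<open>nat\<close>; a permutation of
      \<open>{..<m}\<close> fixes the points outside, so none of these enter.\<close>
    have "u < m" if "x < d" "y < d" "P (x, y) u \<in> a y" for u x y
      using permutes_in_image[OF voltages_permutes[OF \<open>P \<in> voltages m d\<close> that(1,2)]] that sub by auto
    then have "(\<forall>x<d. \<forall>y<d. P (x, y) -` a y \<subseteq> w x)
        \<longleftrightarrow> (\<forall>x<d. \<forall>y<d. \<forall>u<m. (P (x, y) u, y) \<in> Y \<longrightarrow> (u, x) \<in> W)"
      unfolding a_def w_def by blast
    moreover have "((lift_edges m d P)\<inverse> `` Y \<subseteq> W)
        \<longleftrightarrow> (\<forall>x<d. \<forall>y<d. \<forall>u<m. (P (x, y) u, y) \<in> Y \<longrightarrow> (u, x) \<in> W)"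
      using assms(1) unfolding lift_edges_def by blast
    ultimately show ?thesis by simp
  qed
  then have "{P \<in> voltages m d. (lift_edges m d P)\<inverse> `` Y \<subseteq> W}
      = {P \<in> voltages m d. \<forall>x<d. \<forall>y<d. P (x, y) -` a y \<subseteq> w x}" by blast
  then have "real (card {P \<in> voltages m d. (lift_edges m d P)\<inverse> `` Y \<subseteq> W})
      = (\<Prod>x<d. \<Prod>y<d. real (card {p. p permutes {..<m} \<and> p -` a y \<subseteq> w x}))"
    using card_voltages_filter[of m d "\<lambda>x y p. p -` a y \<subseteq> w x"] by simp
  also have "\<dots> \<le> (\<Prod>x<d. \<Prod>y<d. fact m * (card (w x) / m) ^ card (a y))"
    using card_permutes_vimage_subset_le[of "{..<m}", OF _ sub] by (intro prod_mono conjI prod_nonneg) auto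
  also have "\<dots> = fact m ^ (d * d) * (\<Prod>x<d. \<Prod>y<d. (card (w x) / m) ^ card (a y))"
    by (simp add: prod.distrib power_mult)
  \<comment> \<open>The averaging in \<open>prod_fibre_ratio_le\<close> runs over the inner index,
    which therefore has to be the one of the fibres of \<open>W\<close>.\<close>
  also have "(\<Prod>x<d. \<Prod>y<d. (card (w x) / m) ^ card (a y)) = (\<Prod>y<d. \<Prod>x<d. (card (w x) / m) ^ card (a y))"
    by (rule prod.swap)
  also have "fact m ^ (d * d) * \<dots>
      \<le> fact m ^ (d * d) * (real (\<Sum>y<d. card (w y)) / (m * d)) ^ (d * (\<Sum>x<d. card (a x)))"
    by (intro mult_left_mono prod_fibre_ratio_le) auto
  finally show ?thesis
    unfolding card_voltages card_eq_sum_fibres[OF assms(1)] card_eq_sum_fibres[OF assms(2)] a_def w_def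
    by simp
qed

section \<open>Union bounds over the bad events\<close>

lemma binomial_le_exp_power:
  assumes "1 \<le> j" "j \<le> N"
  shows "real (N choose j) \<le> (exp 1 * N / j) ^ j"
proof -
  \<comment> \<open>The left side is a single term of the binomial expansion of
    \<open>(j / N + 1) ^ N\<close>.\<close>
  have "real (N choose j) * (j / N) ^ j * 1 ^ (N - j) \<le> (\<Sum>i\<le>N. real (N choose i) * (j / N) ^ i * 1 ^ (N - i))"
    using assms by (intro member_le_sum) auto
  also have "\<dots> = (j / N + 1) ^ N" by (rule binomial_ring[symmetric])
  also have "\<dots> \<le> exp (j / N) ^ N"
    using exp_ge_add_one_self[of "j / N"] by (intro power_mono) (auto simp: add.commute)
  also have "\<dots> = exp 1 ^ j"
    using assms by (simp add: exp_of_nat_mult[symmetric])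
  finally have "real (N choose j) * (j / N) ^ j \<le> exp 1 ^ j" by simp
  then show ?thesis using assms by (simp add: power_divide power_mult_distrib field_simps)
qed

text \<open>The two binomials cost at most \<open>(3 / s) ^ (6 * k)\<close> for
  \<open>s = 3 * k / N\<close>. As \<open>s \<le> 1 / 2\<close> and \<open>d - 6 \<ge> 13\<close>,
  the base of the \<open>k\<close>-th power is at most \<open>729 / 2 ^ 13 < 1 / 8\<close>.\<close>

lemma small_set_union_bound:
  assumes "1 \<le> k" "6 * k \<le> N" "19 \<le> d"
  shows "real (N choose k) * real (N choose (3 * k)) * (real (3 * k) / N) ^ (d * k) \<le> (1 / 8) ^ k"
proof -
  define s where "s = real (3 * k) / N"
  have s: "0 < s" "s \<le> 1 / 2" using assms by (auto simp: s_def field_simps)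
  have "N choose k \<le> N choose (3 * k)" using assms by (intro binomial_mono) auto
  moreover have "real (N choose (3 * k)) \<le> (3 / s) ^ (3 * k)"
  proof -
    have "real (N choose (3 * k)) \<le> (exp 1 * N / real (3 * k)) ^ (3 * k)"
      using assms by (intro binomial_le_exp_power) auto
    also have "\<dots> = (exp 1 / s) ^ (3 * k)" by (simp add: s_def)
    also have "\<dots> \<le> (3 / s) ^ (3 * k)"
      using s exp_le by (intro power_mono divide_right_mono) auto
    finally show ?thesis .
  qed
  ultimately have "real (N choose k) * real (N choose (3 * k)) \<le> (3 / s) ^ (3 * k) * (3 / s) ^ (3 * k)"
    by (intro mult_mono) auto
  then have "real (N choose k) * real (N choose (3 * k)) * s ^ (d * k)
      \<le> (3 / s) ^ (3 * k) * (3 / s) ^ (3 * k) * s ^ (d * k)"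
    using s by (intro mult_right_mono) auto
  also have "\<dots> = ((3 / s) ^ 6 * s ^ d) ^ k"
    unfolding power_mult_distrib power_mult[symmetric] by (simp add: power_add[symmetric])
  also have "(3 / s) ^ 6 * s ^ d = 729 * s ^ (d - 6)"
    using s assms by (simp add: power_divide power_diff)
  also have "(729 * s ^ (d - 6)) ^ k \<le> (729 * (1 / 2) ^ 13) ^ k"
  proof -
    have "s ^ (d - 6) \<le> (1 / 2) ^ (d - 6)" using s by (intro power_mono) auto
    also have "\<dots> \<le> (1 / 2) ^ 13" using assms by (intro power_decreasing) auto
    finally show ?thesis using s by (intro power_mono) auto
  qed
  also have "\<dots> \<le> (1 / 8) ^ k" by (intro power_mono) (auto simp: power_one_over)
  finally show ?thesis by (simp add: s_def)
qed

lemma card_Union_subset_events_le: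
  fixes c :: real
  assumes "finite U" "\<And>Y W. Y \<subseteq> U \<Longrightarrow> W \<subseteq> U \<Longrightarrow> card Y = k \<Longrightarrow> card W = l \<Longrightarrow> real (card (ev Y W)) \<le> c"
  shows "real (card (\<Union>(Y, W)\<in>{Y. Y \<subseteq> U \<and> card Y = k} \<times> {W. W \<subseteq> U \<and> card W = l}. ev Y W))
       \<le> real (card U choose k) * real (card U choose l) * c"
proof -
  let ?I = "{Y. Y \<subseteq> U \<and> card Y = k} \<times> {W. W \<subseteq> U \<and> card W = l}"
  have fin: "finite ?I" using assms(1) by auto
  have "real (card (\<Union>(Y, W)\<in>?I. ev Y W)) \<le> (\<Sum>(Y, W)\<in>?I. real (card (ev Y W)))"
    using card_UN_le[OF fin, of "\<lambda>(Y, W). ev Y W"]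
    by (simp add: case_prod_unfold flip: of_nat_sum)
  also have "\<dots> \<le> (\<Sum>(Y, W)\<in>?I. c)"
    using assms(2) by (intro sum_mono) auto
  also have "\<dots> = real (card U choose k) * real (card U choose l) * c"
    using assms(1) by (simp add: case_prod_unfold card_cartesian_product n_subsets)
  finally show ?thesis .
qed

lemma sum_eighth_powers_le: "(\<Sum>k = 1..n. (1 / 8 :: real) ^ k) \<le> 1 / 7"
proof -
  have "(\<Sum>k = 1..n. (1 / 8 :: real) ^ k) = (1 - (1 / 8) ^ n) / 7"
    by (induction n) (simp_all add: sum.nat_ivl_Suc' diff_divide_distrib)
  then show ?thesis by simp
qed

lemma small_bad_events:
  fixes ev :: "'a set \<Rightarrow> 'a set \<Rightarrow> 'b set" and C :: real
  assumes "finite U" "19 \<le> d"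
    and bound: "\<And>Y W. Y \<subseteq> U \<Longrightarrow> W \<subseteq> U \<Longrightarrow> card (ev Y W) \<le> C * (card W / card U) ^ (d * card Y)"
  shows "card (\<Union>k\<in>{1..card U div 6}. \<Union>(Y, W)\<in>{Y. Y \<subseteq> U \<and> card Y = k} \<times> {W. W \<subseteq> U \<and> card W = 3 * k}. ev Y W)
    \<le> C / 7"
proof -
  let ?I = "\<lambda>k. {Y. Y \<subseteq> U \<and> card Y = k} \<times> {W. W \<subseteq> U \<and> card W = 3 * k}"
  \<comment> \<open>For empty sets the exponent is 0, so the bound reads
    \<open>card (ev {} {}) \<le> C\<close>.\<close>
  have "0 \<le> C" using bound[of "{}" "{}"] by (auto intro: order_trans[OF of_nat_0_le_iff])
  have "real (card (\<Union>(Y, W)\<in>?I k. ev Y W)) \<le> C * (1 / 8) ^ k" if "k \<in> {1..card U div 6}" for k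
  proof -
    have k: "1 \<le> k" "6 * k \<le> card U" using that by auto
    have "real (card (ev Y W)) \<le> C * (real (3 * k) / card U) ^ (d * k)"
      if "Y \<subseteq> U" "W \<subseteq> U" "card Y = k" "card W = 3 * k" for Y W
      using bound[OF that(1,2)] unfolding that(3,4) .
    then have "real (card (\<Union>(Y, W)\<in>?I k. ev Y W))
        \<le> real (card U choose k) * real (card U choose (3 * k)) * (C * (real (3 * k) / card U) ^ (d * k))"
      by (intro card_Union_subset_events_le assms(1))
    also have "\<dots> = C * (real (card U choose k) * real (card U choose (3 * k)) * (real (3 * k) / card U) ^ (d * k))"
      by (simp only: ac_simps)
    also have "\<dots> \<le> C * (1 / 8) ^ k"
      using k assms(2) \<open>0 \<le> C\<close> by (intro mult_left_mono small_set_union_bound)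
    finally show ?thesis .
  qed
  then have "(\<Sum>k = 1..card U div 6. real (card (\<Union>(Y, W)\<in>?I k. ev Y W)))
      \<le> (\<Sum>k = 1..card U div 6. C * (1 / 8) ^ k)"
    by (rule sum_mono)
  also have "\<dots> \<le> C * (1 / 7)"
    unfolding sum_distrib_left[symmetric] using \<open>0 \<le> C\<close> by (intro mult_left_mono sum_eighth_powers_le)
  finally have "(\<Sum>k = 1..card U div 6. real (card (\<Union>(Y, W)\<in>?I k. ev Y W))) \<le> C / 7" by simp
  moreover have "real (card (\<Union>k\<in>{1..card U div 6}. \<Union>(Y, W)\<in>?I k. ev Y W))
      \<le> (\<Sum>k = 1..card U div 6. real (card (\<Union>(Y, W)\<in>?I k. ev Y W)))"
    unfolding of_nat_sum[symmetric] of_nat_le_iff by (intro card_UN_le) simp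
  ultimately show ?thesis by linarith
qed

text \<open>There are at most \<open>4 ^ N\<close> pairs. The degree 72 makes the exponent
  \<open>d * card Y\<close> at least \<open>12 * N\<close>, and \<open>(5 / 6) ^ 12 < 1 / 8\<close>,
  so the total is at most \<open>C * (1 / 2) ^ N\<close>.\<close>

lemma large_bad_events:
  fixes ev :: "'a set \<Rightarrow> 'a set \<Rightarrow> 'b set" and C :: real
  assumes "finite U" "U \<noteq> {}" "72 \<le> d"
    and bound: "\<And>Y W. Y \<subseteq> U \<Longrightarrow> W \<subseteq> U \<Longrightarrow> card (ev Y W) \<le> C * (card W / card U) ^ (d * card Y)"
  shows "card (\<Union>(Y, W)\<in>{Y. Y \<subseteq> U \<and> card U \<le> 6 * card Y} \<times> {W. W \<subseteq> U \<and> 6 * card W \<le> 5 * card U}. ev Y W)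
    \<le> C / 2"
proof -
  let ?I = "{Y. Y \<subseteq> U \<and> card U \<le> 6 * card Y} \<times> {W. W \<subseteq> U \<and> 6 * card W \<le> 5 * card U}"
  let ?N = "card U"
  have "0 \<le> C" using bound[of "{}" "{}"] by (auto intro: order_trans[OF of_nat_0_le_iff])
  have N: "1 \<le> ?N" using assms by (simp add: Suc_le_eq card_gt_0_iff)
  have sub: "?I \<subseteq> Pow U \<times> Pow U" by auto
  then have fin: "finite ?I" by (rule finite_subset) (use assms(1) in auto)
  have "card ?I \<le> card (Pow U \<times> Pow U)"
    using assms(1) by (intro card_mono sub) auto
  also have "\<dots> = 4 ^ ?N"
    using assms(1) by (simp add: card_Pow card_cartesian_product power_mult_distrib[symmetric])
  finally have "card ?I \<le> 4 ^ ?N" .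
  then have card_I: "real (card ?I) \<le> 4 ^ ?N"
    unfolding of_nat_le_iff[where ?'a = real, symmetric] by (simp only: of_nat_power of_nat_numeral)
  have "real (card (ev Y W)) \<le> C * (1 / 8) ^ ?N" if "(Y, W) \<in> ?I" for Y W
  proof -
    have "card W / ?N \<le> 5 / 6" using that N by (auto simp: field_simps)
    then have "(card W / ?N) ^ (d * card Y) \<le> (5 / 6) ^ (d * card Y)"
      by (intro power_mono) auto
    also have "\<dots> \<le> (5 / 6) ^ (12 * ?N)"
    proof (rule power_decreasing)
      have "12 * ?N \<le> 72 * card Y" using that by auto
      also have "\<dots> \<le> d * card Y" using assms(3) by (rule mult_right_mono) simp
      finally show "12 * ?N \<le> d * card Y" .
    qed auto
    also have "\<dots> \<le> (1 / 8) ^ ?N"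
      unfolding power_mult by (intro power_mono) (auto simp: power_divide)
    finally have "C * (card W / ?N) ^ (d * card Y) \<le> C * (1 / 8) ^ ?N"
      using \<open>0 \<le> C\<close> by (rule mult_left_mono)
    then show ?thesis using bound[of Y W] that by auto
  qed
  then have "(\<Sum>(Y, W)\<in>?I. real (card (ev Y W))) \<le> (\<Sum>(Y, W)\<in>?I. C * (1 / 8) ^ ?N)"
    by (intro sum_mono) (simp only: split_paired_all prod.case)
  also have "\<dots> = card ?I * (C * (1 / 8) ^ ?N)"
    by (simp add: case_prod_unfold)
  also have "\<dots> \<le> 4 ^ ?N * (C * (1 / 8) ^ ?N)"
    using card_I \<open>0 \<le> C\<close> by (intro mult_right_mono) auto
  also have "\<dots> = C * (1 / 2) ^ ?N"
    by (simp add: power_mult_distrib[symmetric])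
  also have "\<dots> \<le> C * (1 / 2) ^ 1"
    using \<open>0 \<le> C\<close> N by (intro mult_left_mono power_decreasing) auto
  finally have "(\<Sum>(Y, W)\<in>?I. real (card (ev Y W))) \<le> C / 2" by simp
  moreover have "real (card (\<Union>(Y, W)\<in>?I. ev Y W)) \<le> (\<Sum>(Y, W)\<in>?I. real (card (ev Y W)))"
    using card_UN_le[OF fin, of "\<lambda>(Y, W). ev Y W"]
    by (simp add: case_prod_unfold flip: of_nat_sum)
  ultimately show ?thesis by linarith
qed

text \<open>Both sides are indexed by the same set \<open>U\<close>: a pair \<open>(u, w)\<close> in
  \<open>F\<close> joins the left copy of \<open>u\<close> to the right copy of
  \<open>w\<close>.\<close>

locale bipartite_expander =
  fixes U :: "'u set" and F :: "('u \<times> 'u) set" and d :: nat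
  assumes finite_U: "finite U" and F_subset: "F \<subseteq> U \<times> U"
    and card_Image: "u \<in> U \<Longrightarrow> card (F `` {u}) = d"
    and card_converse_Image: "w \<in> U \<Longrightarrow> card (F\<inverse> `` {w}) = d"
    and expand: "Y \<subseteq> U \<Longrightarrow> 6 * card Y \<le> card U \<Longrightarrow> 3 * card Y \<le> card (F `` Y)"
    and expand_converse: "Y \<subseteq> U \<Longrightarrow> 6 * card Y \<le> card U \<Longrightarrow> 3 * card Y \<le> card (F\<inverse> `` Y)"
    and dense: "Y \<subseteq> U \<Longrightarrow> Z \<subseteq> U \<Longrightarrow> card U \<le> 6 * card Y \<Longrightarrow> card U \<le> 6 * card Z
      \<Longrightarrow> F `` Y \<inter> Z \<noteq> {}"

lemma exists_expanding_lift:
  fixes m d :: nat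
  assumes "1 \<le> m" "72 \<le> d"
  defines "U \<equiv> {..<m} \<times> {..<d}"
  obtains F where "bipartite_expander U F d"
proof -
  let ?V = "voltages m d" and ?F = "lift_edges m d"
  have U: "finite U" "card U = m * d" "U \<noteq> {}"
    using assms(1,2) by (auto simp: U_def lessThan_empty_iff)
  let ?I = "\<lambda>k. {Y. Y \<subseteq> U \<and> card Y = k} \<times> {W. W \<subseteq> U \<and> card W = 3 * k}"
  let ?J = "{Y. Y \<subseteq> U \<and> card U \<le> 6 * card Y} \<times> {W. W \<subseteq> U \<and> 6 * card W \<le> 5 * card U}"
  define ev ev' where "ev Y W = {P \<in> ?V. ?F P `` Y \<subseteq> W}"
    and "ev' Y W = {P \<in> ?V. (?F P)\<inverse> `` Y \<subseteq> W}" for Y W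
  define B1 B2 B3 where "B1 = (\<Union>k\<in>{1..card U div 6}. \<Union>(Y, W)\<in>?I k. ev Y W)"
    and "B2 = (\<Union>k\<in>{1..card U div 6}. \<Union>(Y, W)\<in>?I k. ev' Y W)"
    and "B3 = (\<Union>(Y, W)\<in>?J. ev Y W)"
  have bound: "real (card (ev Y W)) \<le> card ?V * (card W / card U) ^ (d * card Y)"
    "real (card (ev' Y W)) \<le> card ?V * (card W / card U) ^ (d * card Y)"
    if "Y \<subseteq> U" "W \<subseteq> U" for Y W
    using card_voltages_Image_subset_le[of Y m d W] card_voltages_converse_Image_subset_le[of Y m d W] that
    unfolding ev_def ev'_def U_def by simp_all
  \<comment> \<open>The failure probabilities add up to \<open>1/7 + 1/7 + 1/2 < 1\<close>.\<close>
  have "card B1 \<le> card ?V / 7" "card B2 \<le> card ?V / 7" "card B3 \<le> card ?V / 2"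
    unfolding B1_def B2_def B3_def using assms(2)
    by (intro small_bad_events[where d = d] large_bad_events[where d = d] U bound; simp)+
  moreover have "real (card (B1 \<union> B2 \<union> B3)) \<le> card B1 + card B2 + card B3"
    using card_Un_le[of "B1 \<union> B2" B3] card_Un_le[of B1 B2] by linarith
  moreover have "0 < card ?V" by (simp add: card_voltages)
  ultimately have "real (card (B1 \<union> B2 \<union> B3)) < card ?V" by linarith
  moreover have "B1 \<union> B2 \<union> B3 \<subseteq> ?V"
    unfolding B1_def B2_def B3_def ev_def ev'_def by blast
  then have "finite (B1 \<union> B2 \<union> B3)" using finite_voltages finite_subset by blast
  ultimately have "\<not> ?V \<subseteq> B1 \<union> B2 \<union> B3"
    using card_mono[of "B1 \<union> B2 \<union> B3" ?V] by linarith
  then obtain P where P: "P \<in> ?V" "P \<notin> B1" "P \<notin> B2" "P \<notin> B3" by auto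
  have expand: "3 * card Y \<le> card (E `` Y)"
    if small: "6 * card Y \<le> card U" and sub: "E `` Y \<subseteq> U"
      and avoid: "\<And>W. W \<subseteq> U \<Longrightarrow> card W = 3 * card Y \<Longrightarrow> card Y \<noteq> 0 \<Longrightarrow> \<not> E `` Y \<subseteq> W" for E Y
  proof (rule ccontr)
    assume *: "\<not> 3 * card Y \<le> card (E `` Y)"
    \<comment> \<open>A neighbourhood that is too small is enlarged to exactly
      \<open>3 * card Y\<close> points, which fit into \<open>U\<close>, so that it matches one of
      the counted events.\<close>
    obtain W where W: "E `` Y \<subseteq> W" "W \<subseteq> U" "card W = 3 * card Y"
      using exists_subset_between[of "E `` Y" "3 * card Y" U] small sub * U by auto
    have "card Y \<noteq> 0" using * by auto
    with W avoid show False by blast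
  qed
  have F: "?F P \<subseteq> U \<times> U" using lift_edges_subset[OF P(1)] by (simp add: U_def)
  show ?thesis
  proof (rule that[of "?F P"], unfold_locales)
    show "3 * card Y \<le> card (?F P `` Y)" if "Y \<subseteq> U" "6 * card Y \<le> card U" for Y
    proof (rule expand[OF that(2)])
      fix W assume "W \<subseteq> U" "card W = 3 * card Y" "card Y \<noteq> 0"
      then have "card Y \<in> {1..card U div 6}" "(Y, W) \<in> ?I (card Y)" using that U by auto
      then show "\<not> ?F P `` Y \<subseteq> W" using P(1,2) unfolding B1_def ev_def by blast
    qed (use F in auto)
    show "3 * card Y \<le> card ((?F P)\<inverse> `` Y)" if "Y \<subseteq> U" "6 * card Y \<le> card U" for Y
    proof (rule expand[OF that(2)])
      fix W assume "W \<subseteq> U" "card W = 3 * card Y" "card Y \<noteq> 0"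
      then have "card Y \<in> {1..card U div 6}" "(Y, W) \<in> ?I (card Y)" using that U by auto
      then show "\<not> (?F P)\<inverse> `` Y \<subseteq> W" using P(1,3) unfolding B2_def ev'_def by blast
    qed (use F in auto)
    show "?F P `` Y \<inter> Z \<noteq> {}"
      if "Y \<subseteq> U" "Z \<subseteq> U" "card U \<le> 6 * card Y" "card U \<le> 6 * card Z" for Y Z
    proof
      assume "?F P `` Y \<inter> Z = {}"
      then have "?F P `` Y \<subseteq> U - Z" using F by auto
      \<comment> \<open>If no edge joins \<open>Y\<close> to \<open>Z\<close>, the complement of
        \<open>Z\<close> is a set of at most 5/6 of \<open>U\<close> that traps the neighbourhood of
        \<open>Y\<close>.\<close>
      moreover have "(Y, U - Z) \<in> ?J"
        using that U card_Diff_subset[OF finite_subset[OF that(2) U(1)] that(2)] by simp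
      ultimately show False using P(1,4) unfolding B3_def ev_def by blast
    qed
  qed (use F U P(1) in \<open>auto simp: U_def card_lift_edges_Image card_lift_edges_converse_Image\<close>)
qed

section \<open>Non-Hamiltonian graphs\<close>

lemma pcas_closed_under_arcs:
  assumes "pcas u p v" "\<And>e. e \<in> set p \<Longrightarrow> fst e \<in> C \<Longrightarrow> snd e \<in> C" "u \<in> C"
  shows "v \<in> C \<and> fst ` set p \<subseteq> C"
  using assms by (induction u p v rule: pcas.induct) auto

text \<open>On a closed walk the end is also the start, so a walk meeting \<open>C\<close> then lies
  wholly in \<open>C\<close> by \<open>pcas_closed_under_arcs\<close>.\<close>

lemma pcas_end_in_closed:
  assumes "pcas u p v" "\<And>e. e \<in> set p \<Longrightarrow> fst e \<in> C \<Longrightarrow> snd e \<in> C" "fst ` set p \<inter> C \<noteq> {}"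
  shows "v \<in> C"
  using assms
proof (induction u p v rule: pcas.induct)
  case (2 u e es v)
  show ?case
  proof (cases "fst e \<in> C")
    case True
    then show ?thesis using pcas_closed_under_arcs[of "snd e" es v C] 2 by auto
  qed (use 2 in auto)
qed auto

text \<open>A Hamiltonian cycle leaves every component of \<open>G - S\<close> towards \<open>S\<close>, and the arcs by which
  it does so have distinct heads.\<close>

lemma not_hamiltonian_if_many_components:
  assumes "finite S" "S \<noteq> {}" "S \<subseteq> pverts G"
    and part: "\<And>u v. (u, v) \<in> parcs G \<Longrightarrow> u \<notin> S \<Longrightarrow> v \<notin> S \<Longrightarrow> part u = part v"
    and many: "card S < card (part ` (pverts G - S))"
  shows "\<not> hamiltonian G"
proof
  interpret pair_pre_digraph G .
  assume "hamiltonian G"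
  then obtain p u where p: "pcas u p u" "set p \<subseteq> parcs G" "distinct (tl (pawalk_verts u p))" "p \<noteq> []"
    and span: "pverts G \<subseteq> fst ` set p"
    unfolding hamiltonian_def cycle_def awalk_def by auto
  \<comment> \<open>The vertex list without its first entry is the list of heads of the
    arcs.\<close>
  have "distinct (map snd p)"
    using p awalk_verts_conv'[of u p u] by simp
  then have inj: "inj_on snd (set p)" by (simp add: distinct_map)
  define H where "H = {e \<in> set p. fst e \<notin> S \<and> snd e \<in> S}"
  have "part ` (pverts G - S) \<subseteq> (part \<circ> fst) ` H"
  proof
    fix c assume "c \<in> part ` (pverts G - S)"
    then obtain v where v: "v \<in> pverts G" "v \<notin> S" "c = part v" by auto
    define C where "C = {w. w \<notin> S \<and> part w = c}"
    show "c \<in> (part \<circ> fst) ` H"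
    proof (rule ccontr)
      assume "c \<notin> (part \<circ> fst) ` H"
      then have closed: "snd e \<in> C" if "e \<in> set p" "fst e \<in> C" for e
        using that part[of "fst e" "snd e"] p(2) by (force simp: C_def H_def)
      have "fst ` set p \<inter> C \<noteq> {}" using v span by (auto simp: C_def)
      then have "fst ` set p \<subseteq> C"
        using pcas_closed_under_arcs[OF p(1) closed] pcas_end_in_closed[OF p(1) closed] by blast
      then show False using assms(2,3) span by (fastforce simp: C_def)
    qed
  qed
  then have "card (part ` (pverts G - S)) \<le> card H"
    using surj_card_le[of H] by (simp add: H_def)
  also have "\<dots> = card (snd ` H)"
    using inj by (intro card_image[symmetric]) (auto simp: H_def inj_on_def)
  also have "\<dots> \<le> card S" using assms(1) by (intro card_mono) (auto simp: H_def)
  finally show False using many by simp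
qed

text \<open>Transport along \<open>to_nat\<close> lets the construction use a datatype of vertices.
  \<open>part\<close> is constant on components of the graph minus \<open>S\<close>, and the
  expansion hypothesis is cleared of denominators.\<close>

lemma exists_nat_copy:
  fixes V :: "'a::countable set" and adj :: "'a \<Rightarrow> 'a \<Rightarrow> bool" and part :: "'a \<Rightarrow> 'c"
  assumes "finite V" "symp adj" "irreflp adj"
    and degree: "\<And>v. v \<in> V \<Longrightarrow> card {w \<in> V. adj v w} = d"
    and S: "S \<subseteq> V" "S \<noteq> {}"
    and part: "\<And>u v. adj u v \<Longrightarrow> u \<notin> S \<Longrightarrow> v \<notin> S \<Longrightarrow> part u = part v"
    and many: "card S < card (part ` (V - S))"
    and expansion: "\<And>X. X \<subseteq> V \<Longrightarrow> 2 * card X \<le> card V \<Longrightarrow>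
      card X \<le> 72 * card {v \<in> V - X. \<exists>x\<in>X. adj v x}"
  shows "\<exists>G :: nat pair_pre_digraph. pair_graph G \<and> \<not> hamiltonian G \<and> regular_graph G d \<and>
    card (pverts G) = card V \<and>
    (\<forall>X. X \<subseteq> pverts G \<longrightarrow> X \<noteq> {} \<longrightarrow> real (card X) \<le> real (card (pverts G)) / 2 \<longrightarrow>
       real (card (external_neighborhood G X)) \<ge> real (card X) / 72)"
proof -
  let ?f = "to_nat :: 'a \<Rightarrow> nat"
  define G where "G = \<lparr>pverts = ?f ` V, parcs = {(?f u, ?f v) | u v. u \<in> V \<and> v \<in> V \<and> adj u v}\<rparr>"
  have verts: "pverts G = ?f ` V" by (simp add: G_def)
  have inj: "inj_on ?f A" for A by (meson inj_on_subset inj_to_nat subset_UNIV)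
  have arcs: "(?f u, ?f v) \<in> parcs G \<longleftrightarrow> u \<in> V \<and> v \<in> V \<and> adj u v" for u v by (auto simp: G_def)
  have arcsE: "\<exists>u v. e = (?f u, ?f v) \<and> u \<in> V \<and> v \<in> V \<and> adj u v" if "e \<in> parcs G" for e
    using that by (auto simp: G_def)
  have "pair_graph G"
  proof
    have "parcs G \<subseteq> ?f ` V \<times> ?f ` V" by (auto simp: G_def)
    then show "finite (parcs G)" by (rule finite_subset) (use assms(1) in auto)
    show "symmetric (with_proj G)"
      using assms(2) by (auto simp: symmetric_def sym_def G_def symp_def)
    show "fst e \<noteq> snd e" if "e \<in> parcs G" for e
      using arcsE[OF that] assms(3) by (auto simp: irreflp_def)
  qed (use assms(1) in \<open>auto simp: G_def\<close>)
  moreover have "\<not> hamiltonian G"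
  proof (rule not_hamiltonian_if_many_components[where S = "?f ` S" and part = "part \<circ> from_nat"])
    have "pverts G - ?f ` S = ?f ` (V - S)" using inj by (auto simp: verts)
    then show "card (?f ` S) < card ((part \<circ> from_nat) ` (pverts G - ?f ` S))"
      using many by (simp add: image_comp comp_def card_image[OF inj])
    show "(part \<circ> from_nat) u = (part \<circ> from_nat) v"
      if uv: "(u, v) \<in> parcs G" "u \<notin> ?f ` S" "v \<notin> ?f ` S" for u v
    proof -
      obtain a b where "u = ?f a" "v = ?f b" "adj a b" using arcsE[OF uv(1)] by auto
      then show ?thesis using uv(2,3) part[of a b] by auto
    qed
  qed (use S finite_subset[OF S(1) assms(1)] in \<open>auto simp: verts\<close>)
  moreover have "regular_graph G d"
    unfolding regular_graph_def verts
  proof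
    fix v' assume "v' \<in> ?f ` V"
    then obtain v where v: "v \<in> V" "v' = ?f v" by auto
    then have "out_arcs (with_proj G) v' = (\<lambda>w. (?f v, ?f w)) ` {w \<in> V. adj v w}"
      by (auto simp: out_arcs_def arcs dest!: arcsE)
    then have "out_degree (with_proj G) v' = card ((\<lambda>w. (?f v, ?f w)) ` {w \<in> V. adj v w})"
      by (simp add: out_degree_def)
    also have "\<dots> = card {w \<in> V. adj v w}" by (intro card_image inj_onI) simp
    finally show "out_degree (with_proj G) v' = d" using degree v by simp
  qed
  moreover have "real (card X') / 72 \<le> real (card (external_neighborhood G X'))"
    if "X' \<subseteq> pverts G" "real (card X') \<le> real (card (pverts G)) / 2" for X'
  proof -
    obtain X where X: "X \<subseteq> V" "X' = ?f ` X"
      using \<open>X' \<subseteq> pverts G\<close> unfolding verts by (meson subset_imageE)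
    have "external_neighborhood G X' = ?f ` {v \<in> V - X. \<exists>x\<in>X. adj v x}"
      using X unfolding external_neighborhood_def verts by (auto simp: arcs; blast)
    then show ?thesis
      using expansion[OF X(1)] that(2) by (simp add: verts X(2) card_image[OF inj])
  qed
  ultimately show ?thesis
    by (intro exI[of _ G]) (simp add: verts card_image[OF inj])
qed

section \<open>The adjacency relation of the repaired graph\<close>

text \<open>
  Here \<open>h = d/2\<close>, and \<open>g\<close> enumerates the neighbours of the deleted vertex by pairs \<open>(c, i)\<close> with \<open>i < h\<close>.
  The removed matching of the clique \<open>c\<close> consists of the pairs \<open>{2k, 2k + 1}\<close> below \<open>h\<close>.
\<close>

datatype 'u vertex = Lft 'u | Rgt 'u | Clq bool nat

instance vertex :: (countable) countable
  by countable_datatype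

fun adjacent :: "('u \<times> 'u) set \<Rightarrow> (bool \<times> nat \<Rightarrow> 'u) \<Rightarrow> nat \<Rightarrow> 'u vertex \<Rightarrow> 'u vertex \<Rightarrow> bool" where
  "adjacent F g h (Lft u) (Rgt w) \<longleftrightarrow> (u, w) \<in> F"
| "adjacent F g h (Rgt w) (Lft u) \<longleftrightarrow> (u, w) \<in> F"
| "adjacent F g h (Lft u) (Clq c i) \<longleftrightarrow> i < h \<and> u = g (c, i)"
| "adjacent F g h (Clq c i) (Lft u) \<longleftrightarrow> i < h \<and> u = g (c, i)"
| "adjacent F g h (Clq c i) (Clq c' j) \<longleftrightarrow>
     c = c' \<and> i \<noteq> j \<and> \<not> (i < h \<and> j < h \<and> i div 2 = j div 2)"
| "adjacent F g h _ _ \<longleftrightarrow> False"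

lemma symp_adjacent: "symp (adjacent F g h)"
proof (rule sympI)
  show "adjacent F g h y x" if "adjacent F g h x y" for x y
    using that by (cases x; cases y) auto
qed

lemma irreflp_adjacent: "irreflp (adjacent F g h)"
proof (rule irreflpI)
  show "\<not> adjacent F g h x x" for x by (cases x) auto
qed

definition partner :: "nat \<Rightarrow> nat" where
  "partner i = (if even i then i + 1 else i - 1)"

lemma same_pair_iff: "i div 2 = j div 2 \<longleftrightarrow> j = i \<or> j = partner i" for i j :: nat
  unfolding partner_def by (auto elim!: evenE oddE)

text \<open>An even \<open>h\<close> cuts no pair in two. For \<open>h = d div 2\<close> this is
  where divisibility by 4, and not only by 2, enters.\<close>

lemma partner_less: "even h \<Longrightarrow> i < h \<Longrightarrow> partner i < h"
  unfolding partner_def by (auto elim!: evenE oddE)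

lemma partner_neq: "partner i \<noteq> i"
  unfolding partner_def by (auto elim!: oddE)

section \<open>The graph built from a bipartite expander\<close>

text \<open>Here \<open>N = card U\<close>; \<open>y, z, a, b\<close> are the sizes of the left,
  right and clique parts of \<open>X\<close>, \<open>nl, nr, na, nb\<close> those of its
  neighbourhood, and \<open>fy, fz\<close> the sizes of the neighbourhoods in \<open>F\<close>. The
  1 in the bound on \<open>fy\<close> accounts for the deleted vertex.\<close>

lemma vertex_expansion_arith:
  fixes y z a b nl nr na nb fy fz N d :: nat
  assumes d: "72 \<le> d" "even d" "2 * d \<le> N"
    and size: "y + z + a + b \<le> N + d"
    and fy: "fy \<le> 1 + z + nr" and fz: "fz \<le> y + nl"
    and small: "6 * y \<le> N \<Longrightarrow> 3 * y \<le> fy" "6 * z \<le> N \<Longrightarrow> 3 * z \<le> fz"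
    and large: "N \<le> 6 * y \<Longrightarrow> 5 * N \<le> 6 * fy" "N \<le> 6 * z \<Longrightarrow> 5 * N \<le> 6 * fz"
    and a: "a \<noteq> 0 \<Longrightarrow> d \<le> a + na" "a \<le> d + 1" "a \<le> d div 2 + 1 + y + nl"
    and b: "b \<noteq> 0 \<Longrightarrow> d \<le> b + nb" "b \<le> d + 1" "b \<le> d div 2 + 1 + y + nl"
  shows "y + z + a + b \<le> 72 * (nl + nr + na + nb)"
proof -
  define H where "H = nl + nr + na + nb"
  have H: "nl + nr \<le> H" "na \<le> H" "nb \<le> H" by (auto simp: H_def)
  obtain e where e: "d = 2 * e" using d(2) by blast
  show ?thesis
  proof (cases "6 * y \<le> N \<and> 6 * z \<le> N")
    case True
    then have "3 * y \<le> fy" "3 * z \<le> fz" using small by auto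
    then have "2 * y + 2 * z \<le> 1 + H" using fy fz H by linarith
    \<comment> \<open>The stray 1 disappears by integrality: \<open>H = 0\<close> forces
      \<open>y + z = 0\<close>.\<close>
    then have yz: "y + z \<le> H" by linarith
    \<comment> \<open>The two lower estimates for a nonempty clique part combine to
      \<open>e \<le> 1 + y + nl + na \<le> 1 + 2 * H\<close>. As \<open>e \<ge> 36\<close>,
      \<open>H\<close> is large enough to absorb the constants in
      \<open>a \<le> 4 * H + 2\<close>.\<close>
    have "a \<le> 8 * H" if "a \<noteq> 0" using a that yz H d e by simp
    moreover have "b \<le> 8 * H" if "b \<noteq> 0" using b that yz H d e by simp
    ultimately show ?thesis using yz H_def by fastforce
  next
    case False
    show ?thesis
    proof (rule ccontr)
      assume "\<not> ?thesis"
      \<comment> \<open>Since \<open>d \<le> N / 2\<close>, this gives \<open>H < N / 48\<close>.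
        One large side then forces the other to be large, and together they have about
        \<open>5 * N / 3\<close> vertices, more than the \<open>N + d\<close> allowed.\<close>
      then have H': "72 * H < N + d" using size by (simp add: H_def)
      consider "N \<le> 6 * y" | "N \<le> 6 * z" using False by linarith
      then show False
      proof cases
        case 1
        then have fy': "5 * N \<le> 6 * fy" by (rule large)
        then have "N \<le> 6 * z" using H' H fy d by linarith
        then have "5 * N \<le> 6 * fz" by (rule large)
        then show False using fy' H' H fy fz d size by linarith
      next
        case 2
        then have fz': "5 * N \<le> 6 * fz" by (rule large)
        then have "N \<le> 6 * y" using H' H fz d by linarith
        then have "5 * N \<le> 6 * fy" by (rule large)
        then show False using fz' H' H fy fz d size by linarith
      qed
    qed
  qed
qed

lemma card_vertex_union:
  assumes "finite A" "finite B" "finite C" "finite D"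
  shows "card (Lft ` A \<union> Rgt ` B \<union> Clq True ` C \<union> Clq False ` D) = card A + card B + card C + card D"
  using assms by ((subst card_Un_disjoint; (auto simp: card_image inj_on_def; fail)?)+)

locale repaired_expander = bipartite_expander U F d
  for U :: "'u set" and F :: "('u \<times> 'u) set" and d :: nat +
  fixes v0 :: 'u and g :: "bool \<times> nat \<Rightarrow> 'u"
  assumes d: "4 dvd d" "72 \<le> d" "2 * d \<le> card U"
    and v0: "v0 \<in> U"
    and g: "bij_betw g (UNIV \<times> {..<d div 2}) (F\<inverse> `` {v0})"
begin

abbreviation "h \<equiv> d div 2"
abbreviation "adj \<equiv> adjacent F g h"

definition vertices :: "'u vertex set" where
  "vertices = Lft ` U \<union> Rgt ` (U - {v0}) \<union> (\<lambda>(c, i). Clq c i) ` (UNIV \<times> {..d})"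

lemma mem_vertices [simp]:
  "Lft u \<in> vertices \<longleftrightarrow> u \<in> U" "Rgt u \<in> vertices \<longleftrightarrow> u \<in> U \<and> u \<noteq> v0" "Clq c i \<in> vertices \<longleftrightarrow> i \<le> d"
  by (auto simp: vertices_def)

lemma even_h: "even h" using d(1) by (auto elim!: dvdE)

lemma g_in_U: "i < h \<Longrightarrow> g (c, i) \<in> U"
  using bij_betw_imp_surj_on[OF g] F_subset by auto

lemma finite_vertices: "finite vertices" using finite_U by (simp add: vertices_def)

lemma card_vertex_parts:
  assumes "finite X"
  shows "card X = card (Lft -` X) + card (Rgt -` X) + card (Clq True -` X) + card (Clq False -` X)"
proof -
  have X: "X = Lft ` (Lft -` X) \<union> Rgt ` (Rgt -` X) \<union> Clq True ` (Clq True -` X) \<union> Clq False ` (Clq False -` X)"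
  proof (intro equalityI subsetI)
    fix x assume "x \<in> X"
    then show "x \<in> Lft ` (Lft -` X) \<union> Rgt ` (Rgt -` X) \<union> Clq True ` (Clq True -` X) \<union> Clq False ` (Clq False -` X)"
    proof (cases x)
      case (Clq c i)
      then show ?thesis using \<open>x \<in> X\<close> by (cases c) auto
    qed auto
  qed auto
  have "finite (Lft -` X)" "finite (Rgt -` X)" "finite (Clq c -` X)" for c
    using assms by (auto intro!: finite_vimageI injI)
  from card_vertex_union[OF this(1,2) this(3)[of True] this(3)[of False]]
  show ?thesis by (subst X)
qed

lemma card_vertices: "card vertices = 2 * card U + 2 * d + 1"
proof -
  have "Lft -` vertices = U" "Rgt -` vertices = U - {v0}" "Clq c -` vertices = {..d}" for c by auto
  moreover have "card U \<noteq> 0" using finite_U v0 by auto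
  ultimately show ?thesis
    using card_vertex_parts[OF finite_vertices] v0 by simp
qed

text \<open>A left vertex that loses the deleted neighbour gains exactly one clique neighbour, and a
  matched clique vertex loses its partner but gains one left neighbour.\<close>

lemma degree_vertices:
  assumes "v \<in> vertices"
  shows "card {w \<in> vertices. adj v w} = d"
proof (cases v)
  case (Lft u)
  let ?N = "{w \<in> vertices. adj v w}" and ?P = "\<lambda>c. {i. i < h \<and> u = g (c, i)}"
  have N: "Lft -` ?N = {}" "Rgt -` ?N = F `` {u} - {v0}" "Clq c -` ?N = ?P c" for c
    using F_subset by (auto simp: Lft)
  have fin: "finite (F `` {u})" using F_subset finite_U by (auto intro: finite_subset)
  \<comment> \<open>The clique neighbours of \<open>u\<close> are its preimages under
    \<open>g\<close>: one if \<open>u\<close> was adjacent to \<open>v0\<close>, none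
    otherwise.\<close>
  have "card (?P True) + card (?P False) = card ((\<lambda>i. (True, i)) ` ?P True \<union> (\<lambda>i. (False, i)) ` ?P False)"
    by (subst card_Un_disjoint) (auto simp: card_image inj_on_def)
  also have "(\<lambda>i. (True, i)) ` ?P True \<union> (\<lambda>i. (False, i)) ` ?P False = {p \<in> UNIV \<times> {..<h}. g p = u}"
    by (auto simp: image_iff)
  also have "card \<dots> = (if (u, v0) \<in> F then 1 else 0)"
  proof (cases "(u, v0) \<in> F")
    case True
    then have "u \<in> g ` (UNIV \<times> {..<h})" using g by (simp add: bij_betw_def)
    then obtain q where "q \<in> UNIV \<times> {..<h}" "g q = u" by blast
    then have "{p \<in> UNIV \<times> {..<h}. g p = u} = {q}"
      using bij_betw_imp_inj_on[OF g] by (auto dest: inj_onD)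
    with True show ?thesis by simp
  next
    case False
    then have "{p \<in> UNIV \<times> {..<h}. g p = u} = {}"
      using bij_betw_imp_surj_on[OF g] by blast
    with False show ?thesis by (simp only: if_False card.empty)
  qed
  moreover have "card (F `` {u} - {v0}) + (if (u, v0) \<in> F then 1 else 0) = card (F `` {u})"
    using card.remove[OF fin, of v0] by (cases "(u, v0) \<in> F") auto
  ultimately show ?thesis
    using card_vertex_parts[of ?N] finite_vertices N assms card_Image by (simp add: Lft)
next
  case (Rgt w)
  then have "{x \<in> vertices. adj v x} = Lft ` (F\<inverse> `` {w})"
    using F_subset by (auto simp: vertices_def)
  also have "card \<dots> = card (F\<inverse> `` {w})" by (intro card_image) (simp add: inj_on_def)
  finally show ?thesis using assms Rgt card_converse_Image by simp
next
  case (Clq c i)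
  have inj: "inj_on (Clq c) A" for A by (simp add: inj_on_def)
  show ?thesis
  proof (cases "i < h")
    case True
    then have "{x \<in> vertices. adj v x} = insert (Lft (g (c, i))) (Clq c ` ({..d} - {i, partner i}))"
      using Clq partner_less[OF even_h True] by (auto simp: vertices_def same_pair_iff g_in_U)
    also have "card \<dots> = Suc (card ({..d} - {i, partner i}))"
      by (subst card_insert_disjoint) (auto simp: card_image[OF inj])
    also have "card ({..d} - {i, partner i}) = d + 1 - 2"
      using True partner_less[OF even_h True] partner_neq[of i] by (subst card_Diff_subset) auto
    finally show ?thesis using d by simp
  next
    case False
    then have "{x \<in> vertices. adj v x} = Clq c ` ({..d} - {i})"
      using Clq by (auto simp: vertices_def)
    then show ?thesis using assms Clq by (simp add: card_image[OF inj])
  qed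
qed

section \<open>Components left after deleting the left side\<close>

primrec component :: "'u vertex \<Rightarrow> 'u vertex" where
  "component (Lft u) = Lft u"
| "component (Rgt u) = Rgt u"
| "component (Clq c i) = Clq c 0"

lemma component_eq:
  assumes "adj v w" "v \<notin> Lft ` U" "w \<notin> Lft ` U"
  shows "component v = component w"
  \<comment> \<open>Since \<open>adj\<close> lives on the whole type, edges at some
    \<open>Lft u\<close> with \<open>u\<close> outside \<open>U\<close> have to be excluded
    too.\<close>
  using assms F_subset by (cases v; cases w) (auto simp: g_in_U)

lemma card_components: "card (Lft ` U) < card (component ` (vertices - Lft ` U))"
proof -
  have "x \<in> component ` (vertices - Lft ` U)" if "x \<in> Rgt ` (U - {v0}) \<union> {Clq True 0, Clq False 0}" for x
    using that by (intro image_eqI[of _ _ x]) auto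
  then have "card (Rgt ` (U - {v0}) \<union> {Clq True 0, Clq False 0}) \<le> card (component ` (vertices - Lft ` U))"
    using finite_vertices by (intro card_mono) auto
  moreover have "card (Rgt ` (U - {v0}) \<union> {Clq True 0, Clq False 0 :: 'u vertex}) = card U - 1 + 2"
    using finite_U v0 by (subst card_Un_disjoint) (auto simp: card_image inj_on_def)
  moreover have "card (Lft ` U) = card U" by (simp add: card_image inj_on_def)
  ultimately show ?thesis by linarith
qed

section \<open>Vertex expansion of the repaired graph\<close>

lemma dense_imp_card_Image_ge:
  assumes "Y \<subseteq> U" "card U \<le> 6 * card Y"
  shows "5 * card U \<le> 6 * card (F `` Y)"
proof (rule ccontr)
  assume *: "\<not> ?thesis"
  have sub: "F `` Y \<subseteq> U" using F_subset by auto
  then have "card (U - F `` Y) = card U - card (F `` Y)"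
    using finite_U finite_subset by (blast intro: card_Diff_subset)
  \<comment> \<open>Otherwise the complement of the image would have more than a sixth of the
    points, and \<open>dense\<close> would give an edge into it.\<close>
  then have "F `` Y \<inter> (U - F `` Y) \<noteq> {}" using * assms by (intro dense) auto
  then show False by blast
qed

lemma dense_imp_card_converse_Image_ge:
  assumes "Y \<subseteq> U" "card U \<le> 6 * card Y"
  shows "5 * card U \<le> 6 * card (F\<inverse> `` Y)"
proof (rule ccontr)
  assume *: "\<not> ?thesis"
  have sub: "F\<inverse> `` Y \<subseteq> U" using F_subset by auto
  then have "card (U - F\<inverse> `` Y) = card U - card (F\<inverse> `` Y)"
    using finite_U finite_subset by (blast intro: card_Diff_subset)
  then have "F `` (U - F\<inverse> `` Y) \<inter> Y \<noteq> {}" using * assms by (intro dense) auto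
  then show False by blast
qed

lemma vertex_expansion:
  assumes "X \<subseteq> vertices" "2 * card X \<le> card vertices"
  shows "card X \<le> 72 * card {v \<in> vertices - X. \<exists>x\<in>X. adj v x}"
proof -
  let ?N = "{v \<in> vertices - X. \<exists>x\<in>X. adj v x}"
  define Y Z A where "Y = Lft -` X" and "Z = Rgt -` X" and "A c = Clq c -` X" for c
  define NL NR NA where "NL = Lft -` ?N" and "NR = Rgt -` ?N" and "NA c = Clq c -` ?N" for c
  have sub: "Y \<subseteq> U" "Z \<subseteq> U" "A c \<subseteq> {..d}" for c using assms(1) by (auto simp: Y_def Z_def A_def)
  have Nsub: "NL \<subseteq> U" "NR \<subseteq> U" "NA c \<subseteq> {..d}" for c by (auto simp: NL_def NR_def NA_def)
  note fin = sub[THEN finite_subset] Nsub[THEN finite_subset]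
  have finX: "finite X" using assms(1) finite_vertices finite_subset by blast
  have X: "card X = card Y + card Z + card (A True) + card (A False)"
    using card_vertex_parts[OF finX] by (simp add: Y_def Z_def A_def)
  have N: "card ?N = card NL + card NR + card (NA True) + card (NA False)"
    using card_vertex_parts[of ?N] finite_vertices by (simp add: NL_def NR_def NA_def)
  have "F `` Y \<subseteq> insert v0 (Z \<union> NR)"
  proof
    fix w assume "w \<in> F `` Y"
    then obtain u where u: "Lft u \<in> X" "(u, w) \<in> F" by (auto simp: Y_def)
    then have "adj (Rgt w) (Lft u)" "w \<in> U" using F_subset by auto
    then show "w \<in> insert v0 (Z \<union> NR)" by (auto simp: Z_def NR_def intro!: bexI[OF _ u(1)])
  qed
  then have "card (F `` Y) \<le> card (insert v0 (Z \<union> NR))"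
    using fin finite_U by (intro card_mono) auto
  also have "\<dots> \<le> 1 + card Z + card NR"
    using card_insert_le_m1[of "Suc (card (Z \<union> NR))" "Z \<union> NR" v0] card_Un_le[of Z NR] by simp
  finally have FY: "card (F `` Y) \<le> 1 + card Z + card NR" .
  have "F\<inverse> `` Z \<subseteq> Y \<union> NL"
  proof
    fix u assume "u \<in> F\<inverse> `` Z"
    then obtain w where w: "Rgt w \<in> X" "(u, w) \<in> F" by (auto simp: Z_def)
    then have "adj (Lft u) (Rgt w)" "u \<in> U" using F_subset by auto
    then show "u \<in> Y \<union> NL" by (auto simp: Y_def NL_def intro!: bexI[OF _ w(1)])
  qed
  then have "card (F\<inverse> `` Z) \<le> card (Y \<union> NL)"
    using fin finite_U by (intro card_mono) auto
  also have "\<dots> \<le> card Y + card NL" by (rule card_Un_le)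
  finally have FZ: "card (F\<inverse> `` Z) \<le> card Y + card NL" .
  \<comment> \<open>One clique vertex in \<open>X\<close> already dominates its clique, apart from
    at most its partner.\<close>
  have near: "d \<le> card (A c) + card (NA c)" if ne: "card (A c) \<noteq> 0" for c
  proof -
    have "A c \<noteq> {}" using ne by auto
    then obtain i where i: "Clq c i \<in> X" by (auto simp: A_def)
    have "{..d} - {partner i} \<subseteq> A c \<union> NA c"
    proof
      fix j assume "j \<in> {..d} - {partner i}"
      then have "j = i \<or> adj (Clq c j) (Clq c i)" "j \<le> d"
        using same_pair_iff[of i j] by auto
      then show "j \<in> A c \<union> NA c" using i by (auto simp: A_def NA_def intro!: bexI[OF _ i])
    qed
    then have "card ({..d} - {partner i}) \<le> card (A c \<union> NA c)"
      using fin by (intro card_mono) auto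
    also have "\<dots> \<le> card (A c) + card (NA c)" by (rule card_Un_le)
    finally show ?thesis by (simp add: card_Diff_singleton_if split: if_splits)
  qed
  \<comment> \<open>The clique vertices with index below \<open>h\<close> have distinct left
    neighbours, each in \<open>X\<close> or in its neighbourhood; only the \<open>h + 1\<close>
    others have none.\<close>
  have leave: "card (A c) \<le> h + 1 + card Y + card NL" for c
  proof -
    have "(\<lambda>i. g (c, i)) ` (A c \<inter> {..<h}) \<subseteq> Y \<union> NL"
    proof
      fix u assume "u \<in> (\<lambda>i. g (c, i)) ` (A c \<inter> {..<h})"
      then obtain i where i: "Clq c i \<in> X" "i < h" "u = g (c, i)" by (auto simp: A_def)
      then have "adj (Lft u) (Clq c i)" "u \<in> U" by (auto simp: g_in_U)
      then show "u \<in> Y \<union> NL" by (auto simp: Y_def NL_def intro!: bexI[OF _ i(1)])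
    qed
    then have "card ((\<lambda>i. g (c, i)) ` (A c \<inter> {..<h})) \<le> card (Y \<union> NL)"
      using fin finite_U by (intro card_mono) auto
    also have "card ((\<lambda>i. g (c, i)) ` (A c \<inter> {..<h})) = card (A c \<inter> {..<h})"
      using bij_betw_imp_inj_on[OF g] by (intro card_image) (auto simp: inj_on_def)
    finally have "card (A c \<inter> {..<h}) \<le> card Y + card NL"
      using card_Un_le[of Y NL] by simp
    moreover have "card (A c) \<le> card (A c \<inter> {..<h}) + card {h..d}"
    proof -
      have "A c \<subseteq> (A c \<inter> {..<h}) \<union> {h..d}" using sub(3)[of c] by force
      then have "card (A c) \<le> card ((A c \<inter> {..<h}) \<union> {h..d})" by (intro card_mono) auto
      then show ?thesis using card_Un_le order_trans by blast
    qed
    moreover have "card {h..d} = h + 1" using d(1) by (auto elim!: dvdE)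
    ultimately show ?thesis by simp
  qed
  have A_le: "card (A c) \<le> d + 1" for c
    using card_mono[OF _ sub(3)[of c]] by simp
  have "even d" using d(1) by (auto elim!: dvdE)
  \<comment> \<open>The order \<open>2 * card U + 2 * d + 1\<close> is odd, so halving it rounds
    down to \<open>card U + d\<close>.\<close>
  moreover have "card Y + card Z + card (A True) + card (A False) \<le> card U + d"
    using assms(2) X card_vertices by simp
  ultimately show ?thesis
    unfolding X N using d sub FY FZ near leave A_le
    by (intro vertex_expansion_arith[where fy = "card (F `` Y)" and fz = "card (F\<inverse> `` Z)" and N = "card U" and d = d])
      (auto intro: expand expand_converse dense_imp_card_Image_ge dense_imp_card_converse_Image_ge)
qed

end

section \<open>Assembly for given degree and lift size\<close>

theorem theorem1p3:
  shows "\<exists>d0::nat. \<forall>d r :: nat. d \<ge> d0 \<longrightarrow> 4 dvd d \<longrightarrow> r \<ge> 1 \<longrightarrow>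
    (\<exists>G :: nat pair_pre_digraph.
       pair_graph G \<and>
       \<not> hamiltonian G \<and>
       regular_graph G d \<and>
       card (pverts G) = 2 ^ (r + 1) * d + 2 * d + 1 \<and>
       (\<forall>X. X \<subseteq> pverts G \<longrightarrow> X \<noteq> {} \<longrightarrow> real (card X) \<le> real (card (pverts G)) / 2 \<longrightarrow>
          real (card (external_neighborhood G X)) \<ge> real (card X) / 72))"
proof (intro exI[of _ 72] allI impI)
  fix d r :: nat
  \<comment> \<open>The threshold 72 for \<open>d\<close> is the degree needed in
    \<open>large_bad_events\<close>; the expansion constant 72 comes in through
    \<open>vertex_expansion_arith\<close>.\<close>
  assume d: "72 \<le> d" "4 dvd d" and r: "1 \<le> r"
  define U :: "(nat \<times> nat) set" where "U = {..<2 ^ r} \<times> {..<d}"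
  have card_U: "card U = 2 ^ r * d" by (simp add: U_def)
  have "(1 :: nat) \<le> 2 ^ r" by simp
  then obtain F where "bipartite_expander U F d"
    unfolding U_def using d(1) by (rule exists_expanding_lift)
  then interpret bipartite_expander U F d .
  have v0: "(0, 0) \<in> U" using d(1) by (simp add: U_def)
  have "finite (F\<inverse> `` {(0, 0)})"
    using card_converse_Image[OF v0] d(1) by (intro card_ge_0_finite) simp
  moreover have "card ((UNIV :: bool set) \<times> {..<d div 2}) = card (F\<inverse> `` {(0, 0)})"
    using card_converse_Image[OF v0] d(2) by (auto simp: card_cartesian_product elim!: dvdE)
  ultimately obtain g :: "bool \<times> nat \<Rightarrow> nat \<times> nat"
    where g: "bij_betw g (UNIV \<times> {..<d div 2}) (F\<inverse> `` {(0, 0)})"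
    using finite_same_card_bij[of "(UNIV :: bool set) \<times> {..<d div 2}" "F\<inverse> `` {(0, 0)}"] by auto
  \<comment> \<open>The assumption \<open>r \<ge> 1\<close> makes \<open>U\<close> large enough
    compared with the two cliques.\<close>
  have "2 ^ 1 \<le> (2 :: nat) ^ r" using r by (intro power_increasing) auto
  then have "2 * d \<le> card U" unfolding card_U by (intro mult_right_mono) auto
  then interpret repaired_expander U F d "(0, 0)" g
    using d v0 g by unfold_locales
  have "card vertices = 2 ^ (r + 1) * d + 2 * d + 1" by (simp add: card_vertices card_U)
  with exists_nat_copy[OF finite_vertices symp_adjacent irreflp_adjacent degree_vertices _ _ component_eq
      card_components vertex_expansion] v0
  show "\<exists>G :: nat pair_pre_digraph.
       pair_graph G \<and>
       \<not> hamiltonian G \<and>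
       regular_graph G d \<and>
       card (pverts G) = 2 ^ (r + 1) * d + 2 * d + 1 \<and>
       (\<forall>X. X \<subseteq> pverts G \<longrightarrow> X \<noteq> {} \<longrightarrow> real (card X) \<le> real (card (pverts G)) / 2 \<longrightarrow>
          real (card (external_neighborhood G X)) \<ge> real (card X) / 72)"
    by (auto simp: vertices_def)
qed

end
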